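(* Let $r$ and $s$ be integers greater than $1$. The map $\Phi\colon(\mathcal{C}_r\times \mathcal{C}_s)^+/\mathrm{SL}_2(\mathbb{Z})\longrightarrow \mathbf{SL}_2^+(r,s)$, which sends the $\mathrm{SL}_2(\mathbb{Z})$-orbit of a pair $(\gamma,\delta)$ of non-intersecting clockwise simple closed paths of lengths $r$ and $s$ (extended to periodic bi-infinite paths with suitably normalised vertices $a_i/b_i$ and $c_j/d_j$) to $\pm\mathbf{M}$, where $m_{i,j}=a_id_j-b_ic_j$, is a one-to-one correspondence (a bijection).
   Context: An $\mathrm{SL}_2$-tiling is a function $\mathbf{M}\colon\mathbb{Z}\times\mathbb{Z}\to\mathbb{Z}$, with $m_{i,j}=\mathbf{M}(i,j)$, such that $m_{i,j}m_{i+1,j+1}-m_{i,j+1}m_{i+1,j}=1$ for all $i,j\in\mathbb{Z}$. $\mathbf{SL}_2^+(r,s)$ is the set of those $\mathrm{SL}_2$-tilings $\mathbf{M}$ such that $m_{i+r,j}=m_{i,j+s}=-m_{i,j}$ for all $i,j\in\mathbb{Z}$, and such that there are integers $k$ and $\ell$ with $m_{i,j}>0$ for $i=k+1,\dots,k+r$ and $j=\ell+1,\dots,\ell+s$; here $\mathbf{M}$ and $-\mathbf{M}$ are identified, and elements are written $\pm\mathbf{M}$. (All such tilings are known to be tame, i.e. every $3\times3$ submatrix of consecutive rows and columns has determinant $0$.) A reduced rational is an expression $a/b$ with $a,b$ coprime integers, where $1/0$ and $(-1)/0$ are allowed and both represent $\infty$. The Farey graph $\mathcal{F}$ has vertex set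 $\mathbb{Q}_\infty=\mathbb{Q}\cup\{\infty\}$, with reduced rationals $a/b$ and $c/d$ adjacent if and only if $ad-bc=\pm1$. A closed path of length $n$ in $\mathcal{F}$ is a sequence $\langle v_0,v_1,\dots,v_n\rangle$ of vertices with $v_i$ adjacent to $v_{i+1}$ for $0\leq i<n$ and $v_0=v_n$; it is simple if $v_0,\dots,v_{n-1}$ are distinct. Identify $\mathbb{R}_\infty=\mathbb{R}\cup\{\infty\}$ with the unit circle by $z\mapsto(iz+1)/(z+i)$ (so $\infty\mapsto i$, $1\mapsto1$, $0\mapsto-i$, $-1\mapsto-1$; decreasing along $\mathbb{R}$ is clockwise). A simple closed path is clockwise if, for all $0\leq i<j<k\leq n-1$, the images of $v_i,v_j,v_k$ are in clockwise order around the unit circle. $\mathcal{C}_n^+$ is the set of clockwise simple closed paths of length $n$ in $\mathcal{F}$. $(\mathcal{C}_r\times\mathcal{C}_s)^+$ is the set of pairs $(\gamma,\delta)\in\mathcal{C}_r^+\times\mathcal{C}_s^+$ that do not intersect one another (i.e. have no vertex in common). A closed path of length $n$ is identified with the bi-infinite path $\langle\dots,v_{-1},v_0,v_1,v_2,\dots\rangle$ with $v_i=v_j$ whenever $i\equiv j\pmod n$. $\mathrm{SL}_2(\mathbb{Z})$ acts on $\mathbb{Q}_\infty$ by Möbius transformations $z\mapsto\frac{az+b}{cz+d}$, preserving adjacency and clockwise order, hence acts (vertexwise and diagonally) on $(\mathcal{C}_r\times\mathcal{C}_s)^+$. Given bi-infinite paths $\gamma,\delta$, write the vertices of $\gamma$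 as reduced rationals $a_i/b_i$ with $a_ib_{i+1}-a_{i+1}b_i=1$ and those of $\delta$ as reduced rationals $c_j/d_j$ with $c_jd_{j+1}-c_{j+1}d_j=1$ for all $i,j\in\mathbb{Z}$ (each possible in exactly two ways, differing by a global sign), and put $m_{i,j}=a_id_j-b_ic_j$. The resulting $\pm\mathbf{M}$ depends only on the $\mathrm{SL}_2(\mathbb{Z})$-orbit of $(\gamma,\delta)$; this is $\Phi$ of that orbit. *)

theory Defs
  imports "HOL-Analysis.Determinants" "HOL-Analysis.Complex_Transcendental"
begin

definition SL2_tiling :: "(int \<Rightarrow> int \<Rightarrow> int) \<Rightarrow> bool" where
  "SL2_tiling M \<longleftrightarrow> (\<forall>i j. M i j * M (i + 1) (j + 1) - M i (j + 1) * M (i + 1) j = 1)"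

text \<open>The tilings \<open>M\<close> and \<open>-M\<close> are identified, so an element \<open>\<plusminus>M\<close> is the set \<open>{M, -M}\<close>.\<close>

definition plus_minus :: "(int \<Rightarrow> int \<Rightarrow> int) \<Rightarrow> (int \<Rightarrow> int \<Rightarrow> int) set" where
  "plus_minus M = {M, \<lambda>i j. - M i j}"

definition SL2_plus :: "int \<Rightarrow> int \<Rightarrow> (int \<Rightarrow> int \<Rightarrow> int) set set" where
  "SL2_plus r s = {plus_minus M | M.
     SL2_tiling M \<and>
     (\<forall>i j. M (i + r) j = - M i j \<and> M i (j + s) = - M i j) \<and>
     (\<exists>k l. \<forall>i\<in>{k + 1..k + r}. \<forall>j\<in>{l + 1..l + s}. M i j > 0)}"

datatype qinf = Fin rat | Infty

text \<open>The vertex represented by the reduced rational \<open>a/b\<close>; only meaningful for coprime \<open>a\<close> and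
  \<open>b\<close>. Negative denominators are allowed, so every vertex has exactly two representations.\<close>

definition vertex :: "int \<Rightarrow> int \<Rightarrow> qinf" where
  "vertex a b = (if b = 0 then Infty else Fin (of_int a / of_int b))"

definition adjacent :: "qinf \<Rightarrow> qinf \<Rightarrow> bool" where
  "adjacent u v \<longleftrightarrow> (\<exists>a b c d. coprime a b \<and> coprime c d \<and> u = vertex a b \<and> v = vertex c d \<and>
     (a * d - b * c = 1 \<or> a * d - b * c = -1))"

text \<open>A closed path \<open>\<langle>v 0, \<dots>, v n\<rangle>\<close> of length \<open>n\<close> is identified with its \<open>n\<close>-periodic
  bi-infinite extension; \<open>v 0 = v n\<close> is an instance of periodicity.\<close>

definition closed_path :: "int \<Rightarrow> (int \<Rightarrow> qinf) \<Rightarrow> bool" where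
  "closed_path n v \<longleftrightarrow>
     (\<forall>i. v (i + n) = v i) \<and> (\<forall>i. 0 \<le> i \<and> i < n \<longrightarrow> adjacent (v i) (v (i + 1)))"

definition simple_closed_path :: "int \<Rightarrow> (int \<Rightarrow> qinf) \<Rightarrow> bool" where
  "simple_closed_path n v \<longleftrightarrow> closed_path n v \<and> inj_on v {0..<n}"

fun to_circle :: "qinf \<Rightarrow> complex" where
  "to_circle (Fin z) = (\<i> * of_rat z + 1) / (of_rat z + \<i>)"
| "to_circle Infty = \<i>"

text \<open>Three points of the unit circle are in clockwise order if they have arguments that
  strictly decrease through less than one full turn.\<close>

definition clockwise_on_circle :: "complex \<Rightarrow> complex \<Rightarrow> complex \<Rightarrow> bool" where
  "clockwise_on_circle x y z \<longleftrightarrow> (\<exists>\<alpha> \<beta> \<gamma>. x = cis \<alpha> \<and> y = cis \<beta> \<and> z = cis \<gamma> \<and>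
     \<alpha> > \<beta> \<and> \<beta> > \<gamma> \<and> \<gamma> > \<alpha> - 2 * pi)"

definition clockwise_path :: "int \<Rightarrow> (int \<Rightarrow> qinf) \<Rightarrow> bool" where
  "clockwise_path n v \<longleftrightarrow> (\<forall>i j k. 0 \<le> i \<and> i < j \<and> j < k \<and> k \<le> n - 1 \<longrightarrow>
     clockwise_on_circle (to_circle (v i)) (to_circle (v j)) (to_circle (v k)))"

definition C_plus :: "int \<Rightarrow> (int \<Rightarrow> qinf) set" where
  "C_plus n = {v. simple_closed_path n v \<and> clockwise_path n v}"

definition CC_plus :: "int \<Rightarrow> int \<Rightarrow> ((int \<Rightarrow> qinf) \<times> (int \<Rightarrow> qinf)) set" where
  "CC_plus r s = {(\<gamma>, \<delta>). \<gamma> \<in> C_plus r \<and> \<delta> \<in> C_plus s \<and> range \<gamma> \<inter> range \<delta> = {}}"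

definition SL2Z :: "(int^2^2) set" where
  "SL2Z = {A. det A = 1}"

fun moebius :: "int^2^2 \<Rightarrow> qinf \<Rightarrow> qinf" where
  "moebius A (Fin z) =
     (let p = of_int (A$1$1) * z + of_int (A$1$2); q = of_int (A$2$1) * z + of_int (A$2$2)
      in if q = 0 then Infty else Fin (p / q))"
| "moebius A Infty =
     (if A$2$1 = 0 then Infty else Fin (of_int (A$1$1) / of_int (A$2$1)))"

definition SL2Z_orbit ::
    "(int \<Rightarrow> qinf) \<times> (int \<Rightarrow> qinf) \<Rightarrow> ((int \<Rightarrow> qinf) \<times> (int \<Rightarrow> qinf)) set" where
  "SL2Z_orbit p = (\<lambda>A. (moebius A \<circ> fst p, moebius A \<circ> snd p)) ` SL2Z"

definition CC_plus_mod_SL2Z ::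
    "int \<Rightarrow> int \<Rightarrow> ((int \<Rightarrow> qinf) \<times> (int \<Rightarrow> qinf)) set set" where
  "CC_plus_mod_SL2Z r s = SL2Z_orbit ` CC_plus r s"

definition normalised_lift :: "(int \<Rightarrow> qinf) \<Rightarrow> (int \<Rightarrow> int) \<Rightarrow> (int \<Rightarrow> int) \<Rightarrow> bool" where
  "normalised_lift v a b \<longleftrightarrow>
     (\<forall>i. coprime (a i) (b i) \<and> v i = vertex (a i) (b i) \<and> a i * b (i + 1) - a (i + 1) * b i = 1)"

text \<open>The set of all \<open>M\<close> obtained from some representative of the orbit and some choice of
  normalised vertices. That this set has the form \<open>{M, -M}\<close>, that is, that \<open>\<Phi>\<close> is well defined,
  is not built in: it is part of the claim that \<open>\<Phi>\<close> maps into \<open>SL2_plus r s\<close>.\<close>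

definition Phi :: "((int \<Rightarrow> qinf) \<times> (int \<Rightarrow> qinf)) set \<Rightarrow> (int \<Rightarrow> int \<Rightarrow> int) set" where
  "Phi O' = {M. \<exists>\<gamma> \<delta> a b c d. (\<gamma>, \<delta>) \<in> O' \<and> normalised_lift \<gamma> a b \<and> normalised_lift \<delta> c d \<and>
     M = (\<lambda>i j. a i * d j - b i * c j)}"

end

theory Submission
  imports Defs
begin

text \<open>Lift the vertices of a path to primitive integer vectors with consecutive determinants 1.
  The vertex of a vector of polar angle \<open>t\<close> lies on the unit circle at angle \<open>pi / 2 - 2 t\<close>, so the
  path is a clockwise simple closed path of length \<open>n\<close> exactly if these vectors sweep out half a turn in \<open>n\<close> steps: \<open>U (i + n) = - U i\<close>, and
  \<open>det (U i) (U j) > 0\<close> for \<open>i < j < i + n\<close>. The tiling is \<open>m i j = det (U i) (V j)\<close>, and a pair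
  of lifts is determined by it up to \<open>SL\<^sub>2(\<int>)\<close>, which gives injectivity. The two paths share no
  vertex exactly if no entry vanishes; then \<open>m i j m (i+1) (j+1) - m i (j+1) m (i+1) j = 1\<close> forces
  the sign of \<open>m i j\<close> to be a product of a row sign and a column sign, each of which changes once
  per period, so that a positive block exists. Conversely, antiperiodicity and a positive block
  make all entries nonzero, so that the columns satisfy a three-term recurrence. Hence the tiling
  factors as \<open>det (U i) (V j)\<close>, and the positive block puts one period of each lift into an open
  half-plane, where consecutive determinants 1 make the vectors turn in one direction.\<close>

section \<open>Primitive vectors and Farey vertices\<close>

definition wedge :: "int \<times> int \<Rightarrow> int \<times> int \<Rightarrow> int" where
  "wedge u v = fst u * snd v - snd u * fst v"

definition vtx :: "int \<times> int \<Rightarrow> qinf" where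
  "vtx u = vertex (fst u) (snd u)"

definition primitive :: "int \<times> int \<Rightarrow> bool" where
  "primitive u \<longleftrightarrow> coprime (fst u) (snd u)"

definition unimodular :: "(int \<Rightarrow> int \<times> int) \<Rightarrow> bool" where
  "unimodular U \<longleftrightarrow> (\<forall>i. wedge (U i) (U (i + 1)) = 1)"

definition antiperiodic :: "int \<Rightarrow> (int \<Rightarrow> int \<times> int) \<Rightarrow> bool" where
  "antiperiodic n U \<longleftrightarrow> (\<forall>i. U (i + n) = - U i)"

definition winding :: "int \<Rightarrow> (int \<Rightarrow> int \<times> int) \<Rightarrow> bool" where
  "winding n U \<longleftrightarrow> unimodular U \<and> antiperiodic n U \<and>
     (\<forall>i j. i < j \<and> j < i + n \<longrightarrow> wedge (U i) (U j) > 0)"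

definition tile :: "(int \<Rightarrow> int \<times> int) \<Rightarrow> (int \<Rightarrow> int \<times> int) \<Rightarrow> int \<Rightarrow> int \<Rightarrow> int" where
  "tile U V = (\<lambda>i j. wedge (U i) (V j))"

lemma wedge_minus [simp]: "wedge (- u) v = - wedge u v" "wedge u (- v) = - wedge u v"
  by (simp_all add: wedge_def)

lemma wedge_self [simp]: "wedge u u = 0"
  by (simp add: wedge_def)

lemma wedge_swap: "wedge v u = - wedge u v"
  by (simp add: wedge_def)

text \<open>The three-term Grassmann-Pluecker relation in the plane. It carries positivity from some
  pairs of vectors to further ones.\<close>

lemma plucker: "wedge a c * wedge b d = wedge a b * wedge c d + wedge b c * wedge a d"
  by (simp add: wedge_def algebra_simps)

text \<open>Determinant 1 makes \<open>v\<close>, \<open>w\<close> a lattice basis, and determinants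
  against a basis are coordinates up to sign.\<close>

lemma wedge_cancel:
  assumes "wedge v w = 1" "wedge u v = wedge u' v" "wedge u w = wedge u' w"
  shows "u = u'"
proof -
  \<comment> \<open>Cramer's rule: \<open>x\<close> is \<open>wedge x w\<close> times
    \<open>v\<close> minus \<open>wedge x v\<close> times \<open>w\<close>.\<close>
  have *: "x = (fst v * wedge x w - fst w * wedge x v, snd v * wedge x w - snd w * wedge x v)"
    if "wedge v w = 1" for x
  proof -
    have "fst x = fst x * wedge v w" "snd x = snd x * wedge v w" using that by auto
    then show ?thesis by (auto simp: wedge_def prod_eq_iff algebra_simps)
  qed
  show ?thesis using *[of u] *[of u'] assms by simp
qed

lemma primitive_wedge:
  assumes "wedge u v = 1"
  shows "primitive u" "primitive v"
proof -
  have "coprime x y" if "x * z - y * t = 1" for x y z t :: int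
  proof (rule coprimeI)
    fix c assume "c dvd x" "c dvd y"
    then have "c dvd x * z - y * t" by (simp add: dvd_diff)
    then show "is_unit c" using that by simp
  qed
  from this[of "fst u" "snd v" "snd u" "fst v"] this[of "snd v" "fst u" "fst v" "snd u"] assms
  show "primitive u" "primitive v"
    by (simp_all add: primitive_def wedge_def algebra_simps coprime_commute)
qed

lemma unimodular_primitive: "unimodular U \<Longrightarrow> primitive (U i)"
  using primitive_wedge(1) unimodular_def by blast

text \<open>A fraction in lowest terms has its numerator and denominator fixed by
  cross-multiplication, up to a common sign.\<close>

lemma primitive_wedge_zero:
  assumes "primitive u" "primitive v" "wedge u v = 0"
  shows "u = v \<or> u = - v"
proof -
  obtain a b c d where uv: "u = (a, b)" "v = (c, d)" by (cases u, cases v)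
  have co: "coprime a b" "coprime c d" and eq: "a * d = c * b"
    using assms by (auto simp: uv primitive_def wedge_def algebra_simps)
  have "\<bar>a\<bar> * \<bar>d\<bar> = \<bar>c\<bar> * \<bar>b\<bar>" using eq by (metis abs_mult)
  then have "\<bar>a\<bar> = \<bar>c\<bar>" "\<bar>b\<bar> = \<bar>d\<bar>"
    using coprime_crossproduct_int[of a b c d] co by (auto simp: algebra_simps)
  then show ?thesis using eq co
    by (auto simp: uv abs_eq_iff)
qed

lemma vtx_eq_wedge:
  assumes "primitive u" "primitive v"
  shows "vtx u = vtx v \<longleftrightarrow> wedge u v = 0"
proof -
  have nz: "fst u \<noteq> 0 \<or> snd u \<noteq> 0" "fst v \<noteq> 0 \<or> snd v \<noteq> 0"
    using assms by (auto simp: primitive_def)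
  have "of_int (fst u) / of_int (snd u) = (of_int (fst v) / of_int (snd v) :: rat) \<longleftrightarrow> wedge u v = 0"
    if "snd u \<noteq> 0" "snd v \<noteq> 0"
  proof -
    have "of_int (fst u) / of_int (snd u) = (of_int (fst v) / of_int (snd v) :: rat) \<longleftrightarrow>
      (of_int (fst u * snd v) :: rat) = of_int (fst v * snd u)"
      using that by (simp add: frac_eq_eq)
    then show ?thesis unfolding of_int_eq_iff by (auto simp: wedge_def algebra_simps)
  qed
  with nz show ?thesis by (auto simp: vtx_def vertex_def wedge_def)
qed

lemma vtx_eq_iff:
  assumes "primitive u" "primitive v"
  shows "vtx u = vtx v \<longleftrightarrow> u = v \<or> u = - v"
  using primitive_wedge_zero[OF assms] vtx_eq_wedge[OF assms] by auto

lemma vtx_minus [simp]: "vtx (- u) = vtx u"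
  by (simp add: vtx_def vertex_def)

lemma adjacent_vtx:
  assumes "primitive u" "primitive v"
  shows "adjacent (vtx u) (vtx v) \<longleftrightarrow> \<bar>wedge u v\<bar> = 1"
proof
  assume "adjacent (vtx u) (vtx v)"
  then obtain a b c d where "coprime a b" "coprime c d" "vtx u = vertex a b" "vtx v = vertex c d"
    "a * d - b * c = 1 \<or> a * d - b * c = - 1"
    unfolding adjacent_def by blast
  then obtain u' v' where *: "primitive u'" "primitive v'" "vtx u = vtx u'" "vtx v = vtx v'"
    "\<bar>wedge u' v'\<bar> = 1"
    using that[of "(a, b)" "(c, d)"] by (auto simp: primitive_def vtx_def wedge_def)
  then have "u = u' \<or> u = - u'" "v = v' \<or> v = - v'"
    using vtx_eq_iff assms by blast+
  then show "\<bar>wedge u v\<bar> = 1" using * by auto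
next
  assume "\<bar>wedge u v\<bar> = 1"
  then show "adjacent (vtx u) (vtx v)"
    using assms unfolding adjacent_def vtx_def primitive_def wedge_def
    by (intro exI[of _ "fst u"] exI[of _ "snd u"] exI[of _ "fst v"] exI[of _ "snd v"]) auto
qed

lemma ex_primitive_vtx: "\<exists>u. primitive u \<and> v = vtx u"
proof (cases v)
  case (Fin q)
  obtain a b where "quotient_of q = (a, b)" by (cases "quotient_of q")
  then have "coprime a b" "b > 0" "q = of_int a / of_int b"
    using quotient_of_coprime quotient_of_denom_pos quotient_of_div by auto
  then show ?thesis using Fin
    by (intro exI[of _ "(a, b)"]) (auto simp: primitive_def vtx_def vertex_def)
next
  case Infty
  then show ?thesis by (intro exI[of _ "(1, 0)"]) (auto simp: primitive_def vtx_def vertex_def)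
qed

section \<open>Clockwise order\<close>

definition cpx :: "int \<times> int \<Rightarrow> complex" where
  "cpx u = Complex (of_int (fst u)) (of_int (snd u))"

lemma wedge_cpx: "real_of_int (wedge u v) = Im (cnj (cpx u) * cpx v)"
  by (simp add: wedge_def cpx_def)

lemma wedge_polar:
  assumes "cpx u = of_real \<rho> * cis x" "cpx v = of_real \<sigma> * cis y"
  shows "real_of_int (wedge u v) = \<rho> * \<sigma> * sin (y - x)"
  unfolding wedge_cpx assms by (simp add: sin_diff algebra_simps)

lemma cpx_nonzero: "primitive u \<Longrightarrow> cpx u \<noteq> 0"
  by (auto simp: cpx_def complex_eq_iff primitive_def)

text \<open>For \<open>z = a / b\<close>, clearing denominators turns
  \<open>(i z + 1) / (z + i)\<close> into \<open>i (a - i b) / (a + i b)\<close>. Only the argument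
  of the vector survives, doubled and reversed, so vectors turning counterclockwise give vertices
  moving clockwise.\<close>

lemma to_circle_vtx:
  assumes "primitive u"
  shows "to_circle (vtx u) = \<i> * cnj (cpx u) / cpx u"
proof (cases "snd u = 0")
  case True
  then have "cnj (cpx u) = cpx u" by (simp add: cpx_def complex_eq_iff)
  then show ?thesis using True cpx_nonzero[OF assms] by (simp add: vtx_def vertex_def)
next
  case False
  define a b where "a = (of_int (fst u) :: complex)" and "b = (of_int (snd u) :: complex)"
  have b: "b \<noteq> 0" using False by (simp add: b_def)
  have w: "cpx u = a + \<i> * b" "cnj (cpx u) = a - \<i> * b"
    by (simp_all add: cpx_def a_def b_def complex_eq_iff)
  have nz: "a + \<i> * b \<noteq> 0" using cpx_nonzero[OF assms] w by simp
  have "to_circle (vtx u) = (\<i> * (a / b) + 1) / (a / b + \<i>)"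
    using False by (simp add: vtx_def vertex_def a_def b_def of_rat_divide)
  also have "\<dots> = ((\<i> * (a / b) + 1) * b) / ((a / b + \<i>) * b)"
    using b by simp
  also have "\<dots> = (\<i> * (a - \<i> * b)) / (a + \<i> * b)"
    using b by (simp add: algebra_simps)
  finally show ?thesis unfolding w(2) unfolding w(1) .
qed

lemma to_circle_polar:
  assumes "primitive u" "cpx u = of_real \<rho> * cis x"
  shows "to_circle (vtx u) = cis (pi / 2 - 2 * x)"
proof -
  have "\<rho> \<noteq> 0" using cpx_nonzero[OF assms(1)] assms(2) by auto
  moreover have "cis (pi / 2 - 2 * x) = \<i> * (cis (- x) / cis x)"
    unfolding cis_divide by (metis cis_mult cis_pi_half diff_conv_add_uminus minus_add_distrib mult_2)
  ultimately show ?thesis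
    unfolding to_circle_vtx[OF assms(1)] assms(2) by (simp add: cis_cnj)
qed

text \<open>The point on the circle fixes the square of the unit vector in direction
  \<open>u\<close>, hence this direction up to sign; \<open>\<rho>\<close> may therefore be
  negative.\<close>

lemma polar_of_circle:
  assumes "primitive u" "to_circle (vtx u) = cis \<alpha>"
  shows "\<exists>\<rho>. \<rho> \<noteq> 0 \<and> cpx u = of_real \<rho> * cis (pi / 4 - \<alpha> / 2)"
proof -
  define A where "A = Arg (cpx u)"
  have nz: "cpx u \<noteq> 0" using cpx_nonzero assms by blast
  have eq: "cpx u = of_real (cmod (cpx u)) * cis A"
    using rcis_cmod_Arg[of "cpx u"] by (simp add: A_def rcis_def)
  have "cis (pi / 2 - 2 * A) = cis \<alpha>" using to_circle_polar[OF assms(1) eq] assms(2) by simp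
  then have "cis (pi / 2) / cis (pi / 2 - 2 * A) = cis (pi / 2) / cis \<alpha>" by simp
  then have "cis (2 * A) = cis (pi / 2 - \<alpha>)" unfolding cis_divide by simp
  then have "cis A ^ 2 = cis (pi / 4 - \<alpha> / 2) ^ 2" by (simp add: Complex.DeMoivre algebra_simps)
  then have "cis A = cis (pi / 4 - \<alpha> / 2) \<or> cis A = - cis (pi / 4 - \<alpha> / 2)"
    by (simp add: power2_eq_iff)
  then show ?thesis
  proof
    assume "cis A = cis (pi / 4 - \<alpha> / 2)"
    with eq nz show ?thesis by (intro exI[of _ "cmod (cpx u)"]) simp
  next
    assume "cis A = - cis (pi / 4 - \<alpha> / 2)"
    with eq nz show ?thesis by (intro exI[of _ "- cmod (cpx u)"]) simp
  qed
qed

lemma polar_relative: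
  assumes "cpx u = of_real \<rho> * cis x" "\<rho> > 0" "wedge u v \<noteq> 0"
  shows "\<exists>\<sigma> \<phi>. \<sigma> \<noteq> 0 \<and> 0 < \<phi> \<and> \<phi> < pi \<and> cpx v = of_real \<sigma> * cis (x + \<phi>)"
proof -
  \<comment> \<open>The sign \<open>e\<close> moves \<open>v\<close> to the left side of the line
    through \<open>u\<close>, so that \<open>z\<close>, the flipped \<open>v\<close> measured
    relative to \<open>u\<close>, has argument strictly between 0 and \<open>pi\<close>.\<close>
  define e :: real where "e = (if wedge u v > 0 then 1 else - 1)"
  define z where "z = of_real e * (cnj (cpx u) * cpx v)"
  have ee: "e * e = 1" "e \<noteq> 0" by (auto simp: e_def)
  have "Im z = e * real_of_int (wedge u v)" unfolding wedge_cpx by (simp add: z_def)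
  then have "Im z > 0" using assms(3) by (auto simp: e_def)
  then have \<phi>: "0 < Arg z" "Arg z < pi" using Arg_lt_pi by auto
  have nz: "z \<noteq> 0" using \<open>Im z > 0\<close> by auto
  have "z = of_real (cmod z) * cis (Arg z)"
    using rcis_cmod_Arg[of z] by (simp add: rcis_def)
  moreover have "of_real e * cis x * z = of_real (e * e) * of_real \<rho> * (cis x * cis (- x)) * cpx v"
    by (simp add: z_def assms(1) cis_cnj)
  then have "of_real \<rho> * cpx v = of_real e * cis x * z"
    using ee by (simp add: cis_mult)
  ultimately have "of_real \<rho> * cpx v = of_real e * cis x * (of_real (cmod z) * cis (Arg z))"
    by simp
  then have "of_real \<rho> * cpx v = of_real (e * cmod z) * cis (x + Arg z)"
    by (simp flip: cis_mult)
  then have "cpx v = of_real (e * cmod z / \<rho>) * cis (x + Arg z)"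
    using assms(2) by (simp add: field_simps)
  then show ?thesis using \<phi> nz assms(2) ee
    by (intro exI[of _ "e * cmod z / \<rho>"] exI[of _ "Arg z"]) auto
qed

text \<open>Each vector occurs twice in the product, so its sign does not matter and only the
  vertices count. In polar form the product is a positive square times three sines of half the
  differences of the circle angles; clockwise order puts these halves between 0 and
  \<open>pi\<close>. Conversely, with \<open>v\<close> and \<open>w\<close> at angles
  \<open>\<phi>\<close> and \<open>\<psi>\<close> in that range relative to \<open>u\<close>, the
  sign of the product is that of \<open>sin (\<psi> - \<phi>)\<close>.\<close>

lemma clockwise_wedge:
  assumes "primitive u" "primitive v" "primitive w"
  shows "clockwise_on_circle (to_circle (vtx u)) (to_circle (vtx v)) (to_circle (vtx w)) \<longleftrightarrow>
    wedge u v * wedge v w * wedge u w > 0" (is "?L \<longleftrightarrow> ?R")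
proof
  assume ?L
  then obtain \<alpha> \<beta> \<gamma> where c: "to_circle (vtx u) = cis \<alpha>" "to_circle (vtx v) = cis \<beta>"
    "to_circle (vtx w) = cis \<gamma>" and o: "\<alpha> > \<beta>" "\<beta> > \<gamma>" "\<gamma> > \<alpha> - 2 * pi"
    by (auto simp: clockwise_on_circle_def)
  obtain \<rho> \<sigma> \<tau> where p: "\<rho> \<noteq> 0" "cpx u = of_real \<rho> * cis (pi / 4 - \<alpha> / 2)"
    "\<sigma> \<noteq> 0" "cpx v = of_real \<sigma> * cis (pi / 4 - \<beta> / 2)"
    "\<tau> \<noteq> 0" "cpx w = of_real \<tau> * cis (pi / 4 - \<gamma> / 2)"
    using polar_of_circle[OF assms(1) c(1)] polar_of_circle[OF assms(2) c(2)]
      polar_of_circle[OF assms(3) c(3)] by blast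
  have "real_of_int (wedge u v * wedge v w * wedge u w) =
    (\<rho> * \<sigma> * \<tau>)\<^sup>2 * (sin (pi / 4 - \<beta> / 2 - (pi / 4 - \<alpha> / 2)) *
       sin (pi / 4 - \<gamma> / 2 - (pi / 4 - \<beta> / 2)) * sin (pi / 4 - \<gamma> / 2 - (pi / 4 - \<alpha> / 2)))"
    by (simp only: of_int_mult wedge_polar[OF p(2,4)] wedge_polar[OF p(4,6)]
        wedge_polar[OF p(2,6)] power2_eq_square mult_ac)
  also have "\<dots> > 0"
    by (intro mult_pos_pos sin_gt_zero) (use p o in auto)
  finally show ?R unfolding of_int_0_less_iff .
next
  assume R: ?R
  then have nz: "wedge u v \<noteq> 0" "wedge u w \<noteq> 0" by auto
  define x where "x = Arg (cpx u)"
  define \<rho> where "\<rho> = cmod (cpx u)"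
  have u: "cpx u = of_real \<rho> * cis x" and \<rho>: "\<rho> > 0"
    using cpx_nonzero[OF assms(1)] rcis_cmod_Arg[of "cpx u"] by (auto simp: x_def \<rho>_def rcis_def)
  obtain \<sigma> \<phi> where v: "\<sigma> \<noteq> 0" "0 < \<phi>" "\<phi> < pi" "cpx v = of_real \<sigma> * cis (x + \<phi>)"
    using polar_relative[OF u \<rho> nz(1)] by blast
  obtain \<tau> \<psi> where w: "\<tau> \<noteq> 0" "0 < \<psi>" "\<psi> < pi" "cpx w = of_real \<tau> * cis (x + \<psi>)"
    using polar_relative[OF u \<rho> nz(2)] by blast
  have "real_of_int (wedge u v * wedge v w * wedge u w) =
    (\<rho> * \<sigma> * \<tau>)\<^sup>2 * (sin (x + \<phi> - x) * sin (x + \<psi> - x)) * sin (x + \<psi> - (x + \<phi>))"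
    by (simp only: of_int_mult wedge_polar[OF u v(4)] wedge_polar[OF v(4) w(4)]
        wedge_polar[OF u w(4)] power2_eq_square mult_ac)
  moreover have "real_of_int (wedge u v * wedge v w * wedge u w) > 0" unfolding of_int_0_less_iff by (rule R)
  moreover have "(\<rho> * \<sigma> * \<tau>)\<^sup>2 * (sin (x + \<phi> - x) * sin (x + \<psi> - x)) > 0"
    using v w \<rho> by (intro mult_pos_pos) (auto intro: sin_gt_zero)
  ultimately have "sin (x + \<psi> - (x + \<phi>)) > 0"
    by (metis zero_less_mult_pos)
  then have s: "sin (\<psi> - \<phi>) > 0" by simp
  have "\<phi> < \<psi>"
  proof (rule ccontr)
    assume "\<not> \<phi> < \<psi>"
    then have "sin (\<phi> - \<psi>) \<ge> 0" using v w by (intro sin_ge_zero) auto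
    moreover have "sin (\<psi> - \<phi>) = - sin (\<phi> - \<psi>)" by (metis minus_diff_eq sin_minus)
    ultimately show False using s by simp
  qed
  then show ?L unfolding clockwise_on_circle_def
      to_circle_polar[OF assms(1) u] to_circle_polar[OF assms(2) v(4)]
      to_circle_polar[OF assms(3) w(4)]
    using v w by (intro exI conjI) (rule refl | simp)+
qed

section \<open>The action of the modular group\<close>

definition act :: "int^2^2 \<Rightarrow> int \<times> int \<Rightarrow> int \<times> int" where
  "act A u = (A$1$1 * fst u + A$1$2 * snd u, A$2$1 * fst u + A$2$2 * snd u)"

lemma wedge_act: "wedge (act A u) (act A v) = det A * wedge u v"
  by (simp add: wedge_def act_def det_2 algebra_simps)

lemma moebius_vtx:
  assumes "primitive u"
  shows "moebius A (vtx u) = vtx (act A u)"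
proof (cases "snd u = 0")
  case True
  then have "fst u \<noteq> 0" using assms by (auto simp: primitive_def)
  then show ?thesis using True by (simp add: vtx_def vertex_def act_def)
next
  case False
  define a b :: rat where "a = of_int (fst u)" and "b = of_int (snd u)"
  have b: "b \<noteq> 0" using False by (simp add: b_def)
  have q: "of_int (A$2$1) * (a / b) + of_int (A$2$2) = of_int (snd (act A u)) / b"
    and p: "of_int (A$1$1) * (a / b) + of_int (A$1$2) = of_int (fst (act A u)) / b"
    using b by (simp_all add: act_def a_def b_def add_divide_distrib)
  have "vtx u = Fin (a / b)" using False by (simp add: vtx_def vertex_def a_def b_def)
  then have "moebius A (vtx u) = (if of_int (snd (act A u)) / b = 0 then Infty
      else Fin (of_int (fst (act A u)) / b / (of_int (snd (act A u)) / b)))"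
    by (simp only: moebius.simps Let_def p q)
  then show ?thesis using b by (simp add: vtx_def vertex_def)
qed

lemma unimodular_act:
  assumes "A \<in> SL2Z" "unimodular U"
  shows "unimodular (\<lambda>i. act A (U i))"
  using assms by (simp add: unimodular_def SL2Z_def wedge_act)

lemma unimodular_minus: "unimodular U \<Longrightarrow> unimodular (\<lambda>i. - U i)"
  by (simp add: unimodular_def)

section \<open>Sign ambiguity of lifts and the value of \<open>Phi\<close> on an orbit\<close>

lemma int_step_constant:
  fixes g :: "int \<Rightarrow> 'a"
  assumes "\<And>i. g (i + 1) = g i"
  shows "g i = g j"
proof -
  have "g i = g 0" for i
  proof (induction i rule: int_induct[where k = 0])
    case (step2 i)
    then show ?case using assms[of "i - 1"] by simp
  qed (simp_all add: assms)
  then show ?thesis by metis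
qed

text \<open>Each vector is fixed up to sign by its vertex. Changing the sign at only one of two
  neighbours would turn their determinant into -1, so the sign is global.\<close>

lemma unimodular_lift_unique:
  assumes "unimodular U" "unimodular U'" "\<And>i. vtx (U' i) = vtx (U i)"
  shows "U' = U \<or> U' = (\<lambda>i. - U i)"
proof -
  have dich: "U' i = U i \<or> U' i = - U i" for i
    using assms vtx_eq_iff unimodular_primitive by metis
  have w: "wedge (U i) (U (i + 1)) = 1" "wedge (U' i) (U' (i + 1)) = 1" for i
    using assms by (auto simp: unimodular_def)
  have nz: "U i \<noteq> - U i" for i
    using w(1)[of i] by (metis wedge_minus(1) one_neq_neg_one)
  have step: "U' (i + 1) = U (i + 1) \<longleftrightarrow> U' i = U i" for i
    using dich[of i] dich[of "i + 1"] w[of i] nz by auto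
  have same: "(U' i = U i) = (U' 0 = U 0)" for i
    by (rule int_step_constant[where g = "\<lambda>i. U' i = U i"]) (rule step)
  show ?thesis using same dich by (metis ext)
qed

lemma normalised_lift_iff:
  "normalised_lift v a b \<longleftrightarrow>
    unimodular (\<lambda>i. (a i, b i)) \<and> v = (\<lambda>i. vtx (a i, b i))"
  using primitive_wedge(1)[of "(a i, b i)" "(a (i + 1), b (i + 1))" for i]
  by (fastforce simp: normalised_lift_def unimodular_def vtx_def primitive_def wedge_def fun_eq_iff
      algebra_simps)

lemma Phi_eq:
  "Phi P = {tile U V | U V. (vtx \<circ> U, vtx \<circ> V) \<in> P \<and> unimodular U \<and> unimodular V}"
proof -
  have "M \<in> Phi P \<longleftrightarrow> M \<in> {tile U V | U V. (vtx \<circ> U, vtx \<circ> V) \<in> P \<and> unimodular U \<and> unimodular V}"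
    for M
  proof
    assume "M \<in> Phi P"
    then obtain a b c d where "((\<lambda>i. vtx (a i, b i)), (\<lambda>i. vtx (c i, d i))) \<in> P"
      "unimodular (\<lambda>i. (a i, b i))" "unimodular (\<lambda>i. (c i, d i))"
      "M = (\<lambda>i j. a i * d j - b i * c j)"
      by (auto simp: Phi_def normalised_lift_iff)
    then show "M \<in> {tile U V | U V. (vtx \<circ> U, vtx \<circ> V) \<in> P \<and> unimodular U \<and> unimodular V}"
      by (intro CollectI exI[of _ "\<lambda>i. (a i, b i)"] exI[of _ "\<lambda>i. (c i, d i)"])
        (simp add: tile_def wedge_def comp_def)
  next
    assume "M \<in> {tile U V | U V. (vtx \<circ> U, vtx \<circ> V) \<in> P \<and> unimodular U \<and> unimodular V}"
    then obtain U V where "(vtx \<circ> U, vtx \<circ> V) \<in> P" "unimodular U" "unimodular V" "M = tile U V"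
      by auto
    moreover from this have "normalised_lift (vtx \<circ> W) (\<lambda>i. fst (W i)) (\<lambda>i. snd (W i))"
      if "unimodular W" for W
      using that by (simp add: normalised_lift_iff comp_def)
    ultimately show "M \<in> Phi P"
      unfolding Phi_def tile_def wedge_def by blast
  qed
  then show ?thesis by blast
qed

lemma tile_minus:
  "tile (\<lambda>i. - U i) V = (\<lambda>i j. - tile U V i j)" "tile U (\<lambda>i. - V i) = (\<lambda>i j. - tile U V i j)"
  by (simp_all add: tile_def)

lemma orbit_vtx:
  assumes "unimodular U" "unimodular V"
  shows "SL2Z_orbit (vtx \<circ> U, vtx \<circ> V) =
    {(vtx \<circ> (\<lambda>i. act A (U i)), vtx \<circ> (\<lambda>i. act A (V i))) | A. A \<in> SL2Z}"
proof -
  have "moebius A \<circ> (vtx \<circ> W) = vtx \<circ> (\<lambda>i. act A (W i))" if "unimodular W" for A W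
    using moebius_vtx unimodular_primitive[OF that] by (auto simp: fun_eq_iff)
  then show ?thesis using assms by (auto simp: SL2Z_orbit_def)
qed

lemma mat_1_SL2Z: "mat 1 \<in> SL2Z" by (simp add: SL2Z_def)

lemma act_mat_1 [simp]: "act (mat 1) u = u"
  by (simp add: act_def mat_def)

text \<open>This is the well-definedness of \<open>Phi\<close>: another representative changes both
  lifts by one matrix of determinant 1, which preserves all \<open>wedge\<close> values, and another
  choice of lifts contributes only global signs.\<close>

lemma Phi_orbit:
  assumes "unimodular U" "unimodular V"
  shows "Phi (SL2Z_orbit (vtx \<circ> U, vtx \<circ> V)) = plus_minus (tile U V)"
proof (intro equalityI subsetI)
  fix M assume "M \<in> Phi (SL2Z_orbit (vtx \<circ> U, vtx \<circ> V))"
  then obtain U' V' A where M: "M = tile U' V'" and un: "unimodular U'" "unimodular V'"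
    and A: "A \<in> SL2Z" and eq: "vtx \<circ> U' = vtx \<circ> (\<lambda>i. act A (U i))"
    "vtx \<circ> V' = vtx \<circ> (\<lambda>i. act A (V i))"
    by (auto simp: Phi_eq orbit_vtx[OF assms])
  have "U' = (\<lambda>i. act A (U i)) \<or> U' = (\<lambda>i. - act A (U i))"
    by (rule unimodular_lift_unique[OF unimodular_act[OF A assms(1)] un(1)])
      (use eq in \<open>simp add: fun_eq_iff\<close>)
  moreover have "V' = (\<lambda>i. act A (V i)) \<or> V' = (\<lambda>i. - act A (V i))"
    by (rule unimodular_lift_unique[OF unimodular_act[OF A assms(2)] un(2)])
      (use eq in \<open>simp add: fun_eq_iff\<close>)
  moreover have "tile (\<lambda>i. act A (U i)) (\<lambda>i. act A (V i)) = tile U V"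
    using A by (simp add: tile_def wedge_act SL2Z_def)
  ultimately show "M \<in> plus_minus (tile U V)"
    by (auto simp: M plus_minus_def tile_minus)
next
  fix M assume M: "M \<in> plus_minus (tile U V)"
  have orb: "(vtx \<circ> U, vtx \<circ> V) \<in> SL2Z_orbit (vtx \<circ> U, vtx \<circ> V)"
    unfolding orbit_vtx[OF assms] using mat_1_SL2Z by (auto intro!: exI[of _ "mat 1"])
  have neg: "vtx \<circ> (\<lambda>i. - U i) = vtx \<circ> U" by (simp add: fun_eq_iff)
  have "tile U V \<in> Phi (SL2Z_orbit (vtx \<circ> U, vtx \<circ> V))"
    using orb assms unfolding Phi_eq by blast
  \<comment> \<open>Negating a single lift keeps the vertices and realises the other sign of the
    tiling.\<close>
  moreover have "tile (\<lambda>i. - U i) V \<in> Phi (SL2Z_orbit (vtx \<circ> U, vtx \<circ> V))"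
    unfolding Phi_eq
    by (intro CollectI exI[of _ "\<lambda>i. - U i"] exI[of _ V]) (use orb assms in \<open>simp add: neg unimodular_minus\<close>)
  ultimately show "M \<in> Phi (SL2Z_orbit (vtx \<circ> U, vtx \<circ> V))"
    using M by (auto simp: plus_minus_def tile_minus)
qed

text \<open>The matrix taking \<open>U 0\<close>, \<open>U 1\<close> to \<open>U' 0\<close>,
  \<open>U' 1\<close> has determinant 1. Equal tilings then force it to take every
  \<open>V j\<close> to \<open>V' j\<close>, by comparison against this basis. Exchanging the two
  pairs of lifts gives equality of orbits.\<close>

lemma tile_eq_orbit_subset:
  assumes "unimodular U" "unimodular V" "unimodular U'" "unimodular V'" "tile U V = tile U' V'"
  shows "SL2Z_orbit (vtx \<circ> U', vtx \<circ> V') \<subseteq> SL2Z_orbit (vtx \<circ> U, vtx \<circ> V)"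
proof
  have w: "wedge (W 0) (W 1) = 1" if "unimodular W" for W
    using that by (metis add_0 unimodular_def)
  \<comment> \<open>the matrix with columns \<open>U' 0, U' 1\<close> times the inverse of the one with columns \<open>U 0, U 1\<close>\<close>
  define A :: "int^2^2" where "A = vector
    [vector [fst (U' 0) * snd (U 1) - fst (U' 1) * snd (U 0), fst (U' 1) * fst (U 0) - fst (U' 0) * fst (U 1)],
     vector [snd (U' 0) * snd (U 1) - snd (U' 1) * snd (U 0), snd (U' 1) * fst (U 0) - snd (U' 0) * fst (U 1)]]"
  have A0: "act A (U 0) = U' 0"
  proof -
    have "act A (U 0) = (fst (U' 0) * wedge (U 0) (U 1), snd (U' 0) * wedge (U 0) (U 1))"
      by (simp add: act_def A_def wedge_def algebra_simps)
    then show ?thesis by (simp add: w assms(1))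
  qed
  have A1: "act A (U 1) = U' 1"
  proof -
    have "act A (U 1) = (fst (U' 1) * wedge (U 0) (U 1), snd (U' 1) * wedge (U 0) (U 1))"
      by (simp add: act_def A_def wedge_def algebra_simps)
    then show ?thesis by (simp add: w assms(1))
  qed
  have det: "det A = 1" using wedge_act[of A "U 0" "U 1"] A0 A1 w assms by simp
  have t: "wedge (U i) (V j) = wedge (U' i) (V' j)" for i j
    using assms(5) by (auto simp: tile_def fun_eq_iff)
  have V: "act A (V j) = V' j" for j
  proof (rule wedge_cancel)
    show "wedge (U' 0) (U' 1) = 1" using w assms by blast
    show "wedge (act A (V j)) (U' 0) = wedge (V' j) (U' 0)"
      using t[of 0 j] wedge_act[of A "V j" "U 0"] det A0 by (metis mult_1 wedge_swap)
    show "wedge (act A (V j)) (U' 1) = wedge (V' j) (U' 1)"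
      using t[of 1 j] wedge_act[of A "V j" "U 1"] det A1 by (metis mult_1 wedge_swap)
  qed
  \<comment> \<open>The roles are exchanged: the images of \<open>V 0\<close> and \<open>V 1\<close>
    are now known and serve as the basis.\<close>
  have U: "act A (U i) = U' i" for i
  proof (rule wedge_cancel)
    show "wedge (V' 0) (V' 1) = 1" using w assms by blast
    show "wedge (act A (U i)) (V' 0) = wedge (U' i) (V' 0)"
      using t[of i 0] wedge_act[of A "U i" "V 0"] det V[of 0] by simp
    show "wedge (act A (U i)) (V' 1) = wedge (U' i) (V' 1)"
      using t[of i 1] wedge_act[of A "U i" "V 1"] det V[of 1] by simp
  qed
  fix p assume "p \<in> SL2Z_orbit (vtx \<circ> U', vtx \<circ> V')"
  then obtain B where B: "B \<in> SL2Z"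
    "p = (vtx \<circ> (\<lambda>i. act B (U' i)), vtx \<circ> (\<lambda>i. act B (V' i)))"
    by (auto simp: orbit_vtx assms)
  have "act (B ** A) u = act B (act A u)" for u
    by (simp add: act_def matrix_matrix_mult_def sum_2 algebra_simps)
  moreover have "B ** A \<in> SL2Z" using B det by (simp add: SL2Z_def det_mul)
  ultimately show "p \<in> SL2Z_orbit (vtx \<circ> U, vtx \<circ> V)"
    unfolding orbit_vtx[OF assms(1,2)] B(2)
    by (intro CollectI exI[of _ "B ** A"]) (simp only: U V)
qed

section \<open>Paths as winding sequences\<close>

text \<open>Serves to choose signs of primitive lifts so that neighbouring determinants
  \<open>1\<close> or \<open>-1\<close> all become 1. Running products work in both directions
  because each \<open>\<epsilon> i\<close> is its own inverse.\<close>

lemma sign_cocycle: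
  fixes \<epsilon> :: "int \<Rightarrow> int"
  assumes "\<And>i. \<bar>\<epsilon> i\<bar> = 1"
  shows "\<exists>\<sigma>. \<forall>i. \<bar>\<sigma> i\<bar> = 1 \<and> \<sigma> (i + 1) = \<sigma> i * \<epsilon> i"
proof (intro exI allI conjI)
  fix i :: int
  \<comment> \<open>At least one of the two index ranges is empty, depending on the sign of
    \<open>i\<close>.\<close>
  let ?\<sigma> = "\<lambda>i. prod \<epsilon> {0..<i} * prod \<epsilon> {i..<0}"
  show "\<bar>?\<sigma> i\<bar> = 1" by (simp add: abs_mult abs_prod assms)
  show "?\<sigma> (i + 1) = ?\<sigma> i * \<epsilon> i"
  proof (cases "i \<ge> 0")
    case True
    then have "{0..<i + 1} = insert i {0..<i}" by auto
    then show ?thesis using True by simp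
  next
    case False
    then have "{i..<0} = insert i {i + 1..<0}" by auto
    moreover have "\<epsilon> i * \<epsilon> i = 1" using assms[of i] by (metis abs_mult_self_eq mult_1)
    ultimately show ?thesis using False by (simp add: mult.assoc mult.left_commute)
  qed
qed

lemma antiperiodic_shift:
  assumes "antiperiodic n U"
  shows "wedge (U (i + q * n)) (U (j + q * n)) = wedge (U i) (U j)"
proof -
  have step: "wedge (U (i + n)) (U (j + n)) = wedge (U i) (U j)" for i j
    using assms by (simp add: antiperiodic_def)
  have "wedge (U (i + (q + 1) * n)) (U (j + (q + 1) * n)) = wedge (U (i + q * n)) (U (j + q * n))" for q
    using step[of "i + q * n" "j + q * n"] by (simp add: algebra_simps)
  then have "wedge (U (i + q * n)) (U (j + q * n)) = wedge (U (i + 0 * n)) (U (j + 0 * n))"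
    by (rule int_step_constant)
  then show ?thesis by simp
qed

text \<open>Both indices can be translated by the same multiple of \<open>n\<close> without changing
  the determinant, so one window of length \<open>n\<close> suffices.\<close>

lemma windingI:
  assumes "unimodular U" "antiperiodic n U" "n > 0"
    and "\<And>i j. m \<le> i \<Longrightarrow> i < j \<Longrightarrow> j < m + n \<Longrightarrow> wedge (U i) (U j) > 0"
  shows "winding n U"
  unfolding winding_def
proof (intro conjI allI impI assms(1,2))
  fix i j assume ij: "i < j \<and> j < i + n"
  define q where "q = - ((i - m) div n)"
  define i' j' where "i' = i + q * n" and "j' = j + q * n"
  have "i' = m + (i - m) mod n" by (simp add: i'_def q_def algebra_simps minus_div_mult_eq_mod [symmetric])
  then have i': "m \<le> i'" "i' < m + n" using assms(3) by auto
  have j': "i' < j'" "j' < i' + n" using ij by (auto simp: i'_def j'_def)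
  have "wedge (U i') (U j') > 0"
  proof (cases "j' < m + n")
    case True
    then show ?thesis using assms(4) i' j' by blast
  next
    case False
    \<comment> \<open>When \<open>j'\<close> leaves the window, \<open>j' - n\<close> lies in it
      before \<open>i'\<close>; the sign from antiperiodicity cancels the sign from swapping the
      arguments.\<close>
    have "U j' = - U (j' - n)" using assms(2) unfolding antiperiodic_def by (metis diff_add_cancel)
    moreover have "wedge (U (j' - n)) (U i') > 0"
      using False j' i' by (intro assms(4)) auto
    ultimately show ?thesis using wedge_swap[of "U (j' - n)" "U i'"] by simp
  qed
  then show "wedge (U i) (U j) > 0"
    unfolding i'_def j'_def antiperiodic_shift[OF assms(2)] .
qed

lemma C_plus_lift:
  assumes "v \<in> C_plus n" "n > 1"
  shows "\<exists>U. winding n U \<and> v = vtx \<circ> U"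
proof -
  have per: "v (i + n) = v i" for i
    using assms by (auto simp: C_plus_def simple_closed_path_def closed_path_def)
  have "v (i + (q + 1) * n) = v (i + q * n)" for i q
    using per[of "i + q * n"] by (simp add: algebra_simps)
  then have "v (i + q * n) = v (i + 0 * n)" for i q by (rule int_step_constant)
  then have per': "v (i + q * n) = v i" for i q by simp
  have adj: "adjacent (v i) (v (i + 1))" for i
  proof -
    have e: "i + (- (i div n)) * n = i mod n" "i + 1 + (- (i div n)) * n = i mod n + 1"
      by (simp_all add: algebra_simps minus_div_mult_eq_mod [symmetric])
    have "adjacent (v (i mod n)) (v (i mod n + 1))"
      using assms by (auto simp: C_plus_def simple_closed_path_def closed_path_def)
    then show ?thesis using per'[of i "- (i div n)"] per'[of "i + 1" "- (i div n)"] unfolding e by simp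
  qed
  obtain P where P: "\<And>i. primitive (P i)" "\<And>i. v i = vtx (P i)"
    using choice[of "\<lambda>i u. primitive u \<and> v i = vtx u"] ex_primitive_vtx by blast
  \<comment> \<open>Adjacency gives the determinants up to sign; the cocycle \<open>\<sigma>\<close>
    repairs the signs.\<close>
  have "\<bar>wedge (P i) (P (i + 1))\<bar> = 1" for i
    using adj[of i] adjacent_vtx P by simp
  from sign_cocycle[of "\<lambda>i. wedge (P i) (P (i + 1))", OF this] obtain \<sigma> where
    \<sigma>: "\<And>i. \<bar>\<sigma> i\<bar> = 1" "\<And>i. \<sigma> (i + 1) = \<sigma> i * wedge (P i) (P (i + 1))" by blast
  define U where "U i = (if \<sigma> i = 1 then P i else - P i)" for i
  have U: "v i = vtx (U i)" for i by (simp add: U_def P)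
  have un: "unimodular U"
    unfolding unimodular_def
  proof
    fix i
    have "\<sigma> i = 1 \<or> \<sigma> i = - 1" "\<sigma> (i + 1) = 1 \<or> \<sigma> (i + 1) = - 1" using \<sigma>(1) by (metis abs_eq_iff abs_1)+
    then show "wedge (U i) (U (i + 1)) = 1" using \<sigma>(2)[of i] by (auto simp: U_def)
  qed
  have pr: "primitive (U i)" for i using un unimodular_primitive by blast
  have cons: "wedge (U i) (U (i + 1)) = 1" for i using un by (simp add: unimodular_def)
  have cw: "wedge (U i) (U j) * wedge (U j) (U k) * wedge (U i) (U k) > 0"
    if "0 \<le> i" "i < j" "j < k" "k < n" for i j k
  proof -
    have "k \<le> n - 1" using that by simp
    with that assms(1) have "clockwise_on_circle (to_circle (v i)) (to_circle (v j)) (to_circle (v k))"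
      unfolding C_plus_def clockwise_path_def by blast
    then show ?thesis unfolding U clockwise_wedge[OF pr pr pr] .
  qed
  \<comment> \<open>In the clockwise triple \<open>0, j, j + 1\<close> the last step has determinant
    1, so the sign at \<open>j\<close> passes on to \<open>j + 1\<close>.\<close>
  have pos0: "j < n \<longrightarrow> wedge (U 0) (U j) > 0" if "j \<ge> 1" for j
    using that
  proof (induction j rule: int_ge_induct)
    case base
    then show ?case using cons[of 0] by simp
  next
    case (step j)
    then show ?case using cw[of 0 j "j + 1"] cons[of j] by (auto simp: zero_less_mult_iff)
  qed
  have pos: "wedge (U i) (U j) > 0" if "0 \<le> i" "i < j" "j < 0 + n" for i j
  proof (cases "i = 0")
    case True
    then show ?thesis using pos0[of j] that by auto
  next
    case False
    then have "wedge (U 0) (U i) > 0" "wedge (U 0) (U j) > 0" using pos0[of i] pos0[of j] that by auto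
    then show ?thesis using cw[of 0 i j] that False by (auto simp: zero_less_mult_iff)
  qed
  have dich: "U (i + n) = U i \<or> U (i + n) = - U i" for i
    using vtx_eq_iff[OF pr pr, of "i + n" i] U per by simp
  have nz: "U i \<noteq> - U i" for i
    using cons[of i] by (metis wedge_minus(1) one_neq_neg_one)
  \<comment> \<open>The vector \<open>U n\<close> is \<open>U 0\<close> up to sign. It lies to the
    left of \<open>U (n - 1)\<close> while \<open>U 0\<close> lies to its right, where
    \<open>n > 1\<close> ensures \<open>0 < n - 1\<close>.\<close>
  have base: "U (0 + n) = - U 0"
  proof -
    have "wedge (U (n - 1)) (U n) = 1" using cons[of "n - 1"] by simp
    moreover have "wedge (U (n - 1)) (U 0) < 0"
      using pos[of 0 "n - 1"] assms(2) wedge_swap[of "U 0" "U (n - 1)"] by simp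
    ultimately show ?thesis using dich[of 0] by auto
  qed
  \<comment> \<open>The determinants at \<open>i\<close> and at \<open>i + n\<close> are both 1, so
    neighbours acquire the same sign after one period.\<close>
  have stepU: "U (i + 1 + n) = - U (i + 1) \<longleftrightarrow> U (i + n) = - U i" for i
    using dich[of i] dich[of "i + 1"] cons[of i] cons[of "i + n"] nz nz[THEN not_sym]
    by (auto simp: algebra_simps)
  have "(U (i + n) = - U i) = (U (0 + n) = - U 0)" for i
    by (rule int_step_constant[where g = "\<lambda>i. U (i + n) = - U i"]) (rule stepU)
  then have "antiperiodic n U" using base by (simp add: antiperiodic_def)
  then have "winding n U" using windingI[OF un _ _ pos] assms(2) by simp
  moreover have "v = vtx \<circ> U" by (simp add: fun_eq_iff U)
  ultimately show ?thesis by blast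
qed

lemma winding_C_plus:
  assumes "winding n U" "n > 1"
  shows "vtx \<circ> U \<in> C_plus n"
proof -
  have un: "unimodular U" and anti: "U (i + n) = - U i" and
    pos: "i < j \<Longrightarrow> j < i + n \<Longrightarrow> wedge (U i) (U j) > 0" for i j
    using assms by (auto simp: winding_def antiperiodic_def)
  have pr: "primitive (U i)" for i using un unimodular_primitive by blast
  have "closed_path n (vtx \<circ> U)"
    using un by (auto simp: closed_path_def anti adjacent_vtx pr unimodular_def)
  moreover have "inj_on (vtx \<circ> U) {0..<n}"
  proof (rule inj_onI)
    fix i j assume "i \<in> {0..<n}" "j \<in> {0..<n}" "(vtx \<circ> U) i = (vtx \<circ> U) j"
    then show "i = j"
      using pos[of i j] pos[of j i] vtx_eq_wedge[OF pr[of i] pr[of j]] vtx_eq_wedge[OF pr[of j] pr[of i]]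
      by (cases i j rule: linorder_cases) auto
  qed
  moreover have "clockwise_path n (vtx \<circ> U)"
    unfolding clockwise_path_def comp_def clockwise_wedge[OF pr pr pr]
    by (intro allI impI mult_pos_pos pos) auto
  ultimately show ?thesis by (simp add: C_plus_def simple_closed_path_def)
qed

text \<open>The determinant against \<open>w\<close> changes sign over a period, so it passes from
  negative to positive somewhere. From there it is positive at both ends of a block of length
  \<open>n\<close>, and the cone spanned by the end vectors contains those between.\<close>

lemma winding_positive_block:
  assumes "winding n U" "n > 1" "\<And>i. wedge (U i) w \<noteq> 0"
  shows "\<exists>k. \<forall>i\<in>{k + 1..k + n}. wedge (U i) w > 0"
proof -
  define f where "f i = wedge (U i) w" for i
  have anti: "U (i + n) = - U i" and
    pos: "i < j \<Longrightarrow> j < i + n \<Longrightarrow> wedge (U i) (U j) > 0" for i j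
    using assms by (auto simp: winding_def antiperiodic_def)
  have fn: "f (i + n) = - f i" and nz: "f i \<noteq> 0" for i by (simp_all add: f_def anti assms)
  obtain m where m: "f m < 0" using nz[of 0] fn[of 0] by (metis linorder_neqE neg_0_less_iff_less neg_less_0_iff_less)
  have "\<exists>k. f k < 0 \<and> f (k + 1) > 0"
  proof (rule ccontr)
    assume no: "\<not> ?thesis"
    \<comment> \<open>Without an upward sign change a negative value would persist forever,
      contradicting \<open>f (m + n) = - f m\<close>.\<close>
    have "f i < 0" if "m \<le> i" for i
      using that
    proof (induction i rule: int_ge_induct)
      case (step i)
      then show ?case using no nz[of "i + 1"] by (metis linorder_neqE)
    qed (rule m)
    from this[of "m + n"] show False using fn[of m] m assms(2) by simp
  qed
  then obtain k where k: "f k < 0" "f (k + 1) > 0" by blast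
  have kn: "f (k + n) > 0" using k fn by simp
  have "f i > 0" if i: "i \<in> {k + 1..k + n}" for i
  proof (cases "i = k + 1 \<or> i = k + n")
    case True
    then show ?thesis using k kn by auto
  next
    case False
    \<comment> \<open>\<open>U i\<close> is a positive combination of \<open>U (k + 1)\<close> and \<open>U (k + n)\<close>.\<close>
    have "wedge (U (k + 1)) (U (k + n)) * f i =
      wedge (U (k + 1)) (U i) * f (k + n) + wedge (U i) (U (k + n)) * f (k + 1)"
      unfolding f_def by (rule plucker)
    also have "\<dots> > 0"
      using False i k kn by (intro add_pos_pos mult_pos_pos pos) auto
    finally show ?thesis using pos[of "k + 1" "k + n"] assms(2) by (simp add: zero_less_mult_iff)
  qed
  then show ?thesis unfolding f_def by blast
qed

text \<open>Inside the open half-plane where \<open>wedge u w > 0\<close>, turning left at each step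
  means turning left overall. The Pluecker relation for \<open>U i\<close>, \<open>U j\<close>,
  \<open>U (j + 1)\<close>, \<open>w\<close> is the induction step.\<close>

lemma block_winding:
  assumes "unimodular U" "antiperiodic n U" "n > 0" "\<And>i. i \<in> {k + 1..k + n} \<Longrightarrow> wedge (U i) w > 0"
  shows "winding n U"
proof (rule windingI[OF assms(1-3)])
  fix i j assume i: "k + 1 \<le> i" and ij: "i < j" and j: "j < k + 1 + n"
  have "i + 1 \<le> j" using ij by simp
  then have "j < k + 1 + n \<longrightarrow> wedge (U i) (U j) > 0"
  proof (induction j rule: int_ge_induct)
    case base
    then show ?case using assms(1) by (simp add: unimodular_def)
  next
    case (step j)
    show ?case
    proof
      assume j: "j + 1 < k + 1 + n"
      have "wedge (U i) (U (j + 1)) * wedge (U j) w =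
        wedge (U i) (U j) * wedge (U (j + 1)) w + wedge (U j) (U (j + 1)) * wedge (U i) w"
        by (rule plucker)
      also have "\<dots> > 0"
      proof (intro add_pos_pos mult_pos_pos assms(4))
        show "wedge (U i) (U j) > 0" using step j by simp
        show "wedge (U j) (U (j + 1)) > 0" using assms(1) by (simp add: unimodular_def)
      qed (use i j step in auto)
      finally show "wedge (U i) (U (j + 1)) > 0"
        using assms(4)[of j] i j step by (simp add: zero_less_mult_iff)
    qed
  qed
  then show "wedge (U i) (U j) > 0" using j by simp
qed

section \<open>Tilings\<close>

text \<open>Multiplicativity of determinants: the matrix of entries is a product of matrices with
  rows from \<open>U\<close> and columns from \<open>V\<close>.\<close>

lemma tile_SL2_tiling:
  assumes "unimodular U" "unimodular V"
  shows "SL2_tiling (tile U V)"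
proof -
  have "tile U V i j * tile U V (i + 1) (j + 1) - tile U V i (j + 1) * tile U V (i + 1) j =
    wedge (U i) (U (i + 1)) * wedge (V j) (V (j + 1))" for i j
    by (simp add: tile_def wedge_def algebra_simps)
  then show ?thesis using assms by (simp add: SL2_tiling_def unimodular_def)
qed

section \<open>Signs of entries and factorisation of a tiling\<close>

lemma int_step_same_sign:
  fixes f :: "int \<Rightarrow> int"
  assumes "\<And>i. f i * f (i + 1) > 0"
  shows "f i * f j > 0"
proof -
  have "sgn (f (i + 1)) = sgn (f i)" for i
    using assms[of i] by (auto simp: zero_less_mult_iff)
  then have "sgn (f i) = sgn (f j)" by (rule int_step_constant)
  moreover have "f i \<noteq> 0" using assms[of i] by auto
  ultimately show ?thesis by (auto simp: sgn_if zero_less_mult_iff split: if_splits)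
qed

text \<open>An elementary cell has positive corner product; chaining cells along columns and then
  along rows gives all rectangles. Thus three corners determine the sign of the fourth.\<close>

lemma tiling_same_sign:
  assumes "SL2_tiling M" "\<And>i j. M i j \<noteq> 0"
  shows "M i j * M i j' * (M i' j * M i' j') > 0"
proof (rule int_step_same_sign[where f = "\<lambda>i. M i j * M i j'"])
  have cell: "M i j * M (i + 1) j * (M i (j + 1) * M (i + 1) (j + 1)) > 0" for i j
  proof -
    have "M i j * M (i + 1) (j + 1) - M i (j + 1) * M (i + 1) j = 1"
      using assms(1) by (simp add: SL2_tiling_def)
    moreover have "M i j * M (i + 1) (j + 1) \<noteq> 0" "M i (j + 1) * M (i + 1) j \<noteq> 0"
      using assms(2) by auto
    \<comment> \<open>Two nonzero integers whose difference is 1 have the same sign.\<close>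
    ultimately have "M i j * M (i + 1) (j + 1) * (M i (j + 1) * M (i + 1) j) > 0"
      unfolding zero_less_mult_iff[of "M i j * M (i + 1) (j + 1)"] by linarith
    then show ?thesis by (simp only: mult_ac)
  qed
  fix i
  have "M i j * M (i + 1) j * (M i j' * M (i + 1) j') > 0"
    by (rule int_step_same_sign[where f = "\<lambda>j. M i j * M (i + 1) j"]) (rule cell)
  then show "M i j * M i j' * (M (i + 1) j * M (i + 1) j') > 0" by (simp only: mult_ac)
qed

lemma ex_shift_in_block:
  fixes n :: int
  assumes "n > 0"
  shows "\<exists>q. i + q * n \<in> {k + 1..k + n}"
proof
  have "i + (- ((i - (k + 1)) div n)) * n = k + 1 + (i - (k + 1)) mod n"
    by (simp add: algebra_simps minus_div_mult_eq_mod [symmetric])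
  moreover have "0 \<le> (i - (k + 1)) mod n" "(i - (k + 1)) mod n < n" using assms by auto
  ultimately show "i + (- ((i - (k + 1)) div n)) * n \<in> {k + 1..k + n}"
    unfolding atLeastAtMost_iff by linarith
qed

lemma antiperiodic_nonzero:
  fixes f :: "int \<Rightarrow> int"
  assumes "\<And>i. f (i + n) = - f i" "n > 0" "\<And>i. i \<in> {k + 1..k + n} \<Longrightarrow> f i \<noteq> 0"
  shows "f i \<noteq> 0"
proof -
  obtain q where q: "i + q * n \<in> {k + 1..k + n}" using ex_shift_in_block[OF assms(2)] by blast
  have "(f (i + (q + 1) * n) = 0) = (f (i + q * n) = 0)" for q
    using assms(1)[of "i + q * n"] by (simp add: algebra_simps)
  then have "(f (i + q * n) = 0) = (f (i + 0 * n) = 0)"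
    by (rule int_step_constant[where g = "\<lambda>q. f (i + q * n) = 0"])
  then show ?thesis using assms(3)[OF q] by simp
qed

lemma tiling_factorisation:
  assumes "SL2_tiling M" "\<And>i j. M i j \<noteq> 0"
  shows "\<exists>U V. unimodular U \<and> unimodular V \<and> M = tile U V"
proof -
  define U where "U i = (M i 0, M i 1)" for i
  \<comment> \<open>Column \<open>j\<close> should be a combination of columns 0 and 1. Rows 0 and 1
    determine its coefficients by Cramer's rule with determinant 1; they are
    \<open>snd (V j)\<close> and \<open>- fst (V j)\<close>.\<close>
  define V where "V j = (M 1 0 * M 0 j - M 0 0 * M 1 j, M 1 1 * M 0 j - M 0 1 * M 1 j)" for j
  have sl: "M i j * M (i + 1) (j + 1) - M i (j + 1) * M (i + 1) j = 1" for i j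
    using assms(1) by (simp add: SL2_tiling_def)
  have sl0: "M 0 0 * M 1 1 - M 0 1 * M 1 0 = 1" using sl[of 0 0] by simp
  have "unimodular U" using sl[of _ 0] by (simp add: unimodular_def U_def wedge_def algebra_simps)
  moreover have "unimodular V"
    unfolding unimodular_def
  proof
    fix j
    have "wedge (V j) (V (j + 1)) =
      (M 0 0 * M 1 1 - M 0 1 * M 1 0) * (M 0 j * M 1 (j + 1) - M 0 (j + 1) * M 1 j)"
      by (simp add: V_def wedge_def algebra_simps)
    then show "wedge (V j) (V (j + 1)) = 1" using sl0 sl[of 0 j] by simp
  qed
  moreover have M: "M i j = wedge (U i) (V j)" for i j
  proof -
    \<comment> \<open>The recurrence coefficient arises as a quotient of entries, hence the passage
      to rationals.\<close>
    define m :: "int \<Rightarrow> int \<Rightarrow> rat" where "m i j = of_int (M i j)" for i j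
    have nz: "m i j \<noteq> 0" for i j by (simp add: m_def assms(2))
    \<comment> \<open>Comparing the cells to the left and to the right of column \<open>j\<close> shows that
      \<open>m i (j - 1) + m i (j + 1)\<close> is a multiple of \<open>m i j\<close> by a factor independent of \<open>i\<close>.\<close>
    define h where "h j i = (m i (j - 1) + m i (j + 1)) / m i j" for i j
    have "h j (i + 1) = h j i" for i j
    proof -
      have "M i j * (M (i + 1) (j - 1) + M (i + 1) (j + 1)) = M (i + 1) j * (M i (j - 1) + M i (j + 1))"
        using sl[of i j] sl[of i "j - 1"] by (simp add: algebra_simps)
      then have "m i j * (m (i + 1) (j - 1) + m (i + 1) (j + 1)) =
        m (i + 1) j * (m i (j - 1) + m i (j + 1))"
        unfolding m_def by (metis of_int_add of_int_mult)
      then show ?thesis using nz by (simp add: h_def frac_eq_eq mult_ac)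
    qed
    then have "h j i = h j 0" for i j by (rule int_step_constant)
    moreover have "m i (j - 1) + m i (j + 1) = h j i * m i j" for i j using nz by (simp add: h_def)
    ultimately have rec: "m i (j + 1) = h j 0 * m i j - m i (j - 1)" for i j
      by (metis add_diff_cancel_left')
    \<comment> \<open>The defect of the factorisation in row \<open>i\<close>. It satisfies the
      column recurrence and vanishes at columns 0 and 1, hence everywhere.\<close>
    define e where "e j = (m i 0 * m 1 1 - m i 1 * m 1 0) * m 0 j
      + (m i 1 * m 0 0 - m i 0 * m 0 1) * m 1 j - m i j" for j
    have e_rec: "e (j + 1) = h j 0 * e j - e (j - 1)" for j
      unfolding e_def rec[of _ j] by (simp add: algebra_simps)
    have m0: "m 0 0 * m 1 1 - m 0 1 * m 1 0 = 1"
      using sl0 unfolding m_def by (metis of_int_1 of_int_diff of_int_mult)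
    have "e 0 = m i 0 * (m 0 0 * m 1 1 - m 0 1 * m 1 0) - m i 0"
      "e 1 = m i 1 * (m 0 0 * m 1 1 - m 0 1 * m 1 0) - m i 1"
      by (simp_all add: e_def algebra_simps)
    then have e01: "e 0 = 0" "e 1 = 0" by (simp_all add: m0)
    \<comment> \<open>A second-order recurrence needs two consecutive zeros to run in either
      direction.\<close>
    have "e j = 0 \<and> e (j + 1) = 0"
    proof (induction j rule: int_induct[where k = 0])
      case base
      then show ?case using e01 by simp
    next
      case (step1 j)
      then show ?case using e_rec[of "j + 1"] by simp
    next
      case (step2 j)
      then have "e j = 0" "e (j + 1) = 0" by auto
      then show ?case using e_rec[of j] by simp
    qed
    then have "e j = 0" by simp
    moreover have "e j = of_int (wedge (U i) (V j) - M i j)"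
      by (simp add: e_def m_def U_def V_def wedge_def algebra_simps)
    ultimately have "wedge (U i) (V j) - M i j = 0" by (metis of_int_eq_0_iff)
    then show ?thesis by simp
  qed
  moreover have "M = tile U V" unfolding tile_def by (intro ext M)
  ultimately show ?thesis by blast
qed

section \<open>Passing between pairs of winding lifts and positive antiperiodic tilings\<close>

lemma tile_in_SL2_plus:
  assumes "winding r U" "winding s V" "r > 1" "s > 1" "range (vtx \<circ> U) \<inter> range (vtx \<circ> V) = {}"
  shows "plus_minus (tile U V) \<in> SL2_plus r s"
proof -
  have un: "unimodular U" "unimodular V" and anti: "U (i + r) = - U i" "V (i + s) = - V i" for i
    using assms by (auto simp: winding_def antiperiodic_def)
  have nz: "wedge (U i) (V j) \<noteq> 0" for i j
    using vtx_eq_wedge[OF unimodular_primitive[OF un(1)] unimodular_primitive[OF un(2)], of i j] assms(5)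
    by auto
  have nz': "wedge (V j) (- U i) \<noteq> 0" for i j
    using nz[of i j] wedge_swap[of "V j" "U i"] by simp
  note til = tile_SL2_tiling[OF un]
  obtain k where k: "\<And>i. i \<in> {k + 1..k + r} \<Longrightarrow> wedge (U i) (V 0) > 0"
    using winding_positive_block[OF assms(1,3) nz] by blast
  \<comment> \<open>The minus sign compensates for swapping the arguments: this yields a positive
    block in row \<open>k + 1\<close>.\<close>
  obtain l where "\<And>j. j \<in> {l + 1..l + s} \<Longrightarrow> wedge (V j) (- U (k + 1)) > 0"
    using winding_positive_block[OF assms(2,4) nz'] by blast
  then have l: "wedge (U (k + 1)) (V j) > 0" if "j \<in> {l + 1..l + s}" for j
    using that wedge_swap[of "U (k + 1)" "V j"] by simp
  have "tile U V i j > 0" if "i \<in> {k + 1..k + r}" "j \<in> {l + 1..l + s}" for i j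
  proof -
    \<comment> \<open>The other three corners lie in column 0 or in row \<open>k + 1\<close>, where
      positivity is known.\<close>
    have "tile U V (k + 1) 0 * tile U V (k + 1) j * (tile U V i 0 * tile U V i j) > 0"
      by (rule tiling_same_sign[OF til]) (simp add: tile_def nz)
    moreover have "tile U V (k + 1) 0 > 0" "tile U V (k + 1) j > 0" "tile U V i 0 > 0"
      using k[of "k + 1"] k[OF that(1)] l[OF that(2)] assms(3) by (simp_all add: tile_def)
    ultimately show ?thesis by (metis mult_pos_pos zero_less_mult_pos)
  qed
  moreover have "tile U V (i + r) j = - tile U V i j \<and> tile U V i (j + s) = - tile U V i j" for i j
    by (simp add: tile_def anti)
  ultimately show ?thesis using til unfolding SL2_plus_def by blast
qed

lemma SL2_plus_tile:
  assumes "P \<in> SL2_plus r s" "r > 1" "s > 1"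
  shows "\<exists>U V. winding r U \<and> winding s V \<and> range (vtx \<circ> U) \<inter> range (vtx \<circ> V) = {} \<and>
    P = plus_minus (tile U V)"
proof -
  obtain M k l where P: "P = plus_minus M" and til: "SL2_tiling M"
    and anti: "\<And>i j. M (i + r) j = - M i j" "\<And>i j. M i (j + s) = - M i j"
    and pos: "\<And>i j. i \<in> {k + 1..k + r} \<Longrightarrow> j \<in> {l + 1..l + s} \<Longrightarrow> M i j > 0"
    using assms(1) unfolding SL2_plus_def by blast
  have nz: "M i j \<noteq> 0" for i j
  proof (rule antiperiodic_nonzero[of "\<lambda>i. M i j" r k])
    fix i assume i: "i \<in> {k + 1..k + r}"
    show "M i j \<noteq> 0"
      by (rule antiperiodic_nonzero[of "M i" s l]) (use anti assms pos[OF i] in \<open>auto simp: less_le\<close>)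
  qed (use anti assms in auto)
  obtain U V where un: "unimodular U" "unimodular V" and M: "M = tile U V"
    using tiling_factorisation[OF til nz] by blast
  have w: "wedge (W 0) (W 1) = 1" if "unimodular W" for W
    using that by (metis add_0 unimodular_def)
  \<comment> \<open>Antiperiodicity of the entries, tested against the basis \<open>V 0\<close>,
    \<open>V 1\<close>, passes to the vectors.\<close>
  have U: "antiperiodic r U"
    unfolding antiperiodic_def
    using wedge_cancel[OF w[OF un(2)]] anti(1) by (simp add: M tile_def)
  have V: "antiperiodic s V"
    unfolding antiperiodic_def
  proof
    fix j
    have "wedge (V (j + s)) (U i) = wedge (- V j) (U i)" for i
      using anti(2)[of i j] wedge_swap[of "U i"] by (simp add: M tile_def)
    then show "V (j + s) = - V j" by (intro wedge_cancel[OF w[OF un(1)]])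
  qed
  \<comment> \<open>Column \<open>l + 1\<close> of the positive block puts one period of
    \<open>U\<close> into an open half-plane; row \<open>k + 1\<close> does the same for
    \<open>V\<close> below.\<close>
  have "winding r U"
    by (rule block_winding[OF un(1) U, of k "V (l + 1)"]) (use pos assms in \<open>auto simp: M tile_def\<close>)
  moreover have "winding s V"
  proof (rule block_winding[OF un(2) V, of l "- U (k + 1)"])
    fix j assume "j \<in> {l + 1..l + s}"
    then show "wedge (V j) (- U (k + 1)) > 0"
      using pos[of "k + 1" j] assms(2) wedge_swap[of "V j" "U (k + 1)"] by (simp add: M tile_def)
  qed (use assms in simp)
  moreover have "vtx (U i) \<noteq> vtx (V j)" for i j
    using vtx_eq_wedge[OF unimodular_primitive[OF un(1)] unimodular_primitive[OF un(2)], of i j]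
      nz[of i j] by (simp add: M tile_def)
  ultimately show ?thesis using P M by (intro exI[of _ U] exI[of _ V]) auto
qed

lemma CC_plus_iff:
  assumes "r > 1" "s > 1"
  shows "p \<in> CC_plus r s \<longleftrightarrow> (\<exists>U V. winding r U \<and> winding s V \<and>
    range (vtx \<circ> U) \<inter> range (vtx \<circ> V) = {} \<and> p = (vtx \<circ> U, vtx \<circ> V))"
proof
  assume "p \<in> CC_plus r s"
  then obtain \<gamma> \<delta> where "p = (\<gamma>, \<delta>)" "\<gamma> \<in> C_plus r" "\<delta> \<in> C_plus s" "range \<gamma> \<inter> range \<delta> = {}"
    by (auto simp: CC_plus_def)
  with C_plus_lift[OF _ assms(1)] C_plus_lift[OF _ assms(2)]
  show "\<exists>U V. winding r U \<and> winding s V \<and>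
    range (vtx \<circ> U) \<inter> range (vtx \<circ> V) = {} \<and> p = (vtx \<circ> U, vtx \<circ> V)"
    by metis
qed (use assms in \<open>auto simp: CC_plus_def intro: winding_C_plus\<close>)

theorem theorem1p8:
  fixes r s :: int
  assumes "r > 1" and "s > 1"
  shows "bij_betw Phi (CC_plus_mod_SL2Z r s) (SL2_plus r s)"
  unfolding bij_betw_def
proof (rule conjI[OF inj_onI equalityI[OF subsetI subsetI]])
  fix x y
  assume "x \<in> CC_plus_mod_SL2Z r s" "y \<in> CC_plus_mod_SL2Z r s" and eq: "Phi x = Phi y"
  then obtain U V U' V' where un: "unimodular U" "unimodular V" "unimodular U'" "unimodular V'"
    and xy: "x = SL2Z_orbit (vtx \<circ> U, vtx \<circ> V)" "y = SL2Z_orbit (vtx \<circ> U', vtx \<circ> V')"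
    unfolding CC_plus_mod_SL2Z_def image_iff Bex_def CC_plus_iff[OF assms] winding_def by blast
  have "tile U V \<in> plus_minus (tile U' V')"
    using eq unfolding xy Phi_orbit[OF un(1,2)] Phi_orbit[OF un(3,4)] by (auto simp: plus_minus_def)
  \<comment> \<open>Equal classes leave a global sign, which is absorbed into the lift
    \<open>U'\<close>; this alters neither its vertices nor the orbit.\<close>
  then consider "tile U V = tile U' V'" | "tile U V = tile (\<lambda>i. - U' i) V'"
    by (auto simp: plus_minus_def tile_minus)
  then show "x = y"
  proof cases
    case 1
    then show ?thesis unfolding xy
      using tile_eq_orbit_subset[OF un] tile_eq_orbit_subset[OF un(3,4,1,2)] by auto
  next
    case 2
    have "vtx \<circ> U' = vtx \<circ> (\<lambda>i. - U' i)" by (simp add: fun_eq_iff)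
    then show ?thesis unfolding xy
      using 2 tile_eq_orbit_subset[OF un(1,2) unimodular_minus[OF un(3)] un(4)]
        tile_eq_orbit_subset[OF unimodular_minus[OF un(3)] un(4,1,2)] by auto
  qed
next
  fix P assume "P \<in> Phi ` CC_plus_mod_SL2Z r s"
  then obtain U V where "winding r U" "winding s V" "range (vtx \<circ> U) \<inter> range (vtx \<circ> V) = {}"
    and P: "P = Phi (SL2Z_orbit (vtx \<circ> U, vtx \<circ> V))"
    unfolding CC_plus_mod_SL2Z_def image_iff Bex_def CC_plus_iff[OF assms] by blast
  then show "P \<in> SL2_plus r s"
    using tile_in_SL2_plus assms Phi_orbit by (simp add: winding_def)
next
  fix P assume "P \<in> SL2_plus r s"
  then obtain U V where UV: "winding r U" "winding s V" "range (vtx \<circ> U) \<inter> range (vtx \<circ> V) = {}"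
    and P: "P = plus_minus (tile U V)"
    using SL2_plus_tile assms by blast
  have "SL2Z_orbit (vtx \<circ> U, vtx \<circ> V) \<in> CC_plus_mod_SL2Z r s"
    unfolding CC_plus_mod_SL2Z_def using CC_plus_iff[OF assms] UV by blast
  moreover have "P = Phi (SL2Z_orbit (vtx \<circ> U, vtx \<circ> V))"
    using P UV Phi_orbit by (simp add: winding_def)
  ultimately show "P \<in> Phi ` CC_plus_mod_SL2Z r s" by blast
qed

end
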